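(* Let $\mu$ be a p-Borel measure on $\mathbb{R}^+=(0,+\infty)$ such that (1) if $H\subset\mathbb{R}^+$ is $\mu$-measurable, then so is $H+x$ for all $x>0$; and (2) if $I\subset\mathbb{R}^+$ is a finite (i.e. bounded, non-degenerate) interval, then $0<m_I\le M_I<+\infty$ and $$\lim_{x\to+\infty}\frac{M_{I+x}}{m_{I+x}}=1.$$ Then for every $H\in\mathrm{Dom}(\mathcal{M}^{\mu})$, $$\lim_{x\to+\infty}\left|\mathcal{M}^{\mu}(H+x)-\mathrm{Avg}(H+x)\right|=0.$$
   Context: A p-Borel measure on an interval of $\mathbb{R}$ is a Borel measure $\mu$ on that interval such that $\mu(H)<+\infty$ for every bounded measurable subset $H$ and $\mu(J)>0$ for every non-degenerate subinterval $J$. $\mu$-measurable means measurable with respect to the completion of $\mu$. $\mathrm{Dom}(\mathcal{M}^{\mu})$ is the family of bounded $\mu$-measurable sets $H$ with $0<\mu(H)<+\infty$, and $\mathcal{M}^{\mu}(H)=\frac{\int_H x\,d\mu}{\mu(H)}$. $\lambda$ is the Lebesgue measure, and $\mathrm{Avg}(H)=\frac{\int_H x\,d\lambda}{\lambda(H)}$ for bounded Lebesgue measurable $H$ with $\lambda(H)>0$. $H+x=\{h+x:h\in H\}$. For a finite interval $I\subset\mathbb{R}^+$, $$m_I=\inf\left\{\tfrac{\mu(H)}{\lambda(H)}:H\subset I,\ H\in\mathrm{Dom}(\mathcal{M}^{\mu})\right\},\qquad M_I=\sup\left\{\tfrac{\mu(H)}{\lambda(H)}:H\subset I,\ H\in\mathrm{Dom}(\mathcal{M}^{\mu})\right\},$$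 where $H$ ranges over Lebesgue measurable sets in $\mathrm{Dom}(\mathcal{M}^{\mu})$ and $\mu(H)/\lambda(H)=+\infty$ if $\lambda(H)=0$. *)

theory Defs
  imports "HOL-Analysis.Analysis"
begin

definition nondegenerate_interval :: "real set \<Rightarrow> bool" where
  "nondegenerate_interval J \<longleftrightarrow> is_interval J \<and> (\<exists>a\<in>J. \<exists>b\<in>J. a < b)"

definition p_borel_measure_on :: "real set \<Rightarrow> real measure \<Rightarrow> bool" where
  "p_borel_measure_on S \<mu> \<longleftrightarrow>
     is_interval S \<and>
     sets \<mu> = sets (restrict_space borel S) \<and>
     (\<forall>H\<in>sets \<mu>. bounded H \<longrightarrow> emeasure \<mu> H < \<infinity>) \<and>
     (\<forall>J. J \<subseteq> S \<and> nondegenerate_interval J \<longrightarrow> 0 < emeasure \<mu> J)"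

abbreviation mu_measurable :: "real measure \<Rightarrow> real set \<Rightarrow> bool" where
  "mu_measurable \<mu> H \<equiv> H \<in> sets (completion \<mu>)"

definition Dom_mean :: "real measure \<Rightarrow> real set set" where
  "Dom_mean \<mu> = {H. bounded H \<and> mu_measurable \<mu> H \<and>
     0 < emeasure (completion \<mu>) H \<and> emeasure (completion \<mu>) H < \<infinity>}"

definition mean :: "real measure \<Rightarrow> real set \<Rightarrow> real" where
  "mean \<mu> H = (LINT x:H|completion \<mu>. x) / measure (completion \<mu>) H"

definition Avg :: "real set \<Rightarrow> real" where
  "Avg H = (LINT x:H|lebesgue. x) / measure lebesgue H"

definition translate :: "real set \<Rightarrow> real \<Rightarrow> real set" where
  "translate H x = {h + x | h. h \<in> H}"

text \<open>
  In \<^typ>\<open>ennreal\<close>, \<open>a / 0 = \<infinity>\<close> for \<open>a > 0\<close>. Since \<open>\<mu>(H) > 0\<close> on \<^const>\<open>Dom_mean\<close>, the quotients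
  below take the value \<open>\<infinity>\<close> exactly when \<open>H\<close> is Lebesgue null.
\<close>

definition density_ratios :: "real measure \<Rightarrow> real set \<Rightarrow> ennreal set" where
  "density_ratios \<mu> I = {emeasure (completion \<mu>) H / emeasure lebesgue H | H.
     H \<subseteq> I \<and> H \<in> Dom_mean \<mu> \<and> H \<in> sets lebesgue}"

definition lower_ratio :: "real measure \<Rightarrow> real set \<Rightarrow> ennreal" where
  "lower_ratio \<mu> I = Inf (density_ratios \<mu> I)"

definition upper_ratio :: "real measure \<Rightarrow> real set \<Rightarrow> ennreal" where
  "upper_ratio \<mu> I = Sup (density_ratios \<mu> I)"

end

theory Submission
  imports Defs
begin

text \<open>
  Write \<open>\<lambda>\<close> for Lebesgue measure. Let \<open>H\<close> lie in \<open>(0, B)\<close>, so that \<open>H + x\<close> lies in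
  \<open>J = (x, x + B)\<close>, and let \<open>m \<le> M\<close> be the extremal ratios of \<open>\<mu>\<close> to \<open>\<lambda>\<close> on \<open>J\<close>. The ratios say
  that \<open>m \<lambda> \<le> \<mu> \<le> M \<lambda>\<close> as measures on \<open>J\<close>, that is, \<open>\<mu>\<close> has a density with values in \<open>[m, M]\<close>.

  The difference of the two means of \<open>H + x\<close> does not change if both are taken relative to the
  left endpoint \<open>x\<close> of \<open>J\<close>, and this removes the growth in \<open>x\<close>: the integrand \<open>y - x\<close> takes values
  in \<open>[0, B]\<close>. It is nonnegative, so replacing \<open>\<lambda>\<close> by \<open>\<mu>\<close> changes numerator and denominator of the
  average each by a factor in \<open>[m, M]\<close>, hence the average by a factor between \<open>m / M\<close> and \<open>M / m\<close>.
  As the averages are at most \<open>B\<close>, they differ by at most \<open>B (M / m - 1)\<close>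
  (\<open>means_diff_le_of_comparable_measures\<close>, \<open>mean_diff_Avg_le\<close>), where \<open>B\<close> depends only on \<open>H\<close> and
  \<open>M / m\<close> tends to 1.

  The ratios only speak of sets of positive \<open>\<mu>\<close>-measure that are measurable for both measures, so
  two points need care. First, the lower bound must also hold for \<open>\<mu>\<close>-null sets: such a set is
  enlarged by intervals whose \<open>\<mu>\<close>-measure is positive but tends to 0
  (\<open>density_bounds_interval\<close>). Secondly, the resulting bounds on Borel sets show that \<open>\<mu>\<close> and \<open>\<lambda>\<close>
  have the same null sets inside \<open>J\<close>, and therefore their completions measure the same subsets
  of \<open>J\<close> (\<open>mu_measurable_iff_lebesgue_interval\<close>).
\<close>

section \<open>Averages with respect to comparable measures\<close>

lemma integral_le_mult_of_measure_le:
  fixes f :: "'a \<Rightarrow> real"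
  assumes sets: "sets M = sets N"
    and le: "\<And>A. A \<in> sets M \<Longrightarrow> emeasure M A \<le> ennreal c * emeasure N A"
    and c: "0 \<le> c"
    and f: "integrable N f" "\<And>x. x \<in> space N \<Longrightarrow> 0 \<le> f x"
  shows "integral\<^sup>L M f \<le> c * integral\<^sup>L N f"
proof -
  have fN: "f \<in> borel_measurable N"
    using f(1) by auto
  have fM: "f \<in> borel_measurable M"
    using fN measurable_cong_sets[OF sets refl] by blast
  have sp: "space M = space N"
    using sets by (rule sets_eq_imp_space_eq)
  have scale: "M \<le> scale_measure (ennreal c) N"
    using sets le by (simp add: le_measure)
  have "(\<integral>\<^sup>+x. ennreal (f x) \<partial>M) \<le> (\<integral>\<^sup>+x. ennreal (f x) \<partial>scale_measure (ennreal c) N)"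
    by (rule nn_integral_mono_measure) (use sets scale in auto)
  also have "\<dots> = ennreal c * (\<integral>\<^sup>+x. ennreal (f x) \<partial>N)"
    by (rule nn_integral_scale_measure) (use fN in measurable)
  also have "(\<integral>\<^sup>+x. ennreal (f x) \<partial>N) = ennreal (integral\<^sup>L N f)"
    using f by (intro nn_integral_eq_integral) auto
  finally have "(\<integral>\<^sup>+x. ennreal (f x) \<partial>M) \<le> ennreal (c * integral\<^sup>L N f)"
    using c by (simp add: ennreal_mult')
  moreover have "0 \<le> c * integral\<^sup>L N f"
    using c f by (intro mult_nonneg_nonneg integral_nonneg_AE) auto
  moreover have "integral\<^sup>L M f = enn2real (\<integral>\<^sup>+x. ennreal (f x) \<partial>M)"
    using fM f(2) sp by (intro integral_eq_nn_integral) auto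
  ultimately show ?thesis
    by (simp add: enn2real_leI)
qed

text \<open>
  Shifting \<open>f\<close> by \<open>a\<close> leaves the difference of the averages unchanged and makes the integrand
  nonnegative. Each of the two averages \<open>A1\<close>, \<open>A2\<close> of \<open>f - a\<close> is then at most \<open>M / m\<close> times the
  other one, and both lie in \<open>[0, b - a]\<close>.
\<close>

lemma means_diff_le_of_comparable_measures:
  fixes f :: "'a \<Rightarrow> real"
  assumes fin: "finite_measure N1" "finite_measure N2"
    and sets: "sets N1 = sets N2"
    and lower: "\<And>A. A \<in> sets N2 \<Longrightarrow> ennreal m * emeasure N2 A \<le> emeasure N1 A"
    and upper: "\<And>A. A \<in> sets N2 \<Longrightarrow> emeasure N1 A \<le> ennreal M * emeasure N2 A"
    and m: "0 < m" and M: "0 < M"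
    and f: "f \<in> borel_measurable N2" "\<And>x. x \<in> space N2 \<Longrightarrow> a \<le> f x" "\<And>x. x \<in> space N2 \<Longrightarrow> f x \<le> b"
    and pos: "0 < measure N2 (space N2)"
  shows "\<bar>integral\<^sup>L N1 f / measure N1 (space N1) - integral\<^sup>L N2 f / measure N2 (space N2)\<bar>
           \<le> (b - a) * (M / m - 1)"
proof -
  interpret N1: finite_measure N1 by fact
  interpret N2: finite_measure N2 by fact
  have sp: "space N1 = space N2"
    using sets by (rule sets_eq_imp_space_eq)
  have f1: "f \<in> borel_measurable N1"
    using f(1) measurable_cong_sets[OF sets refl] by blast
  have i2: "integrable N2 f"
    using f by (intro N2.integrable_const_bound[where B="max \<bar>a\<bar> \<bar>b\<bar>"]) fastforce+
  have i1: "integrable N1 f"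
    using f(2,3) sp f1 by (intro N1.integrable_const_bound[where B="max \<bar>a\<bar> \<bar>b\<bar>"]) fastforce+
  define v1 v2 where "v1 = measure N1 (space N1)" and "v2 = measure N2 (space N2)"
  define A1 A2 where "A1 = (\<integral>x. f x - a \<partial>N1) / v1" and "A2 = (\<integral>x. f x - a \<partial>N2) / v2"
  have v2: "0 < v2"
    using pos by (simp add: v2_def)
  have v12: "v1 \<le> M * v2" and v21: "m * v2 \<le> v1"
    using upper[of "space N2"] lower[of "space N2"] m M
    by (auto simp: v1_def v2_def sp N1.emeasure_eq_measure N2.emeasure_eq_measure
        simp flip: ennreal_mult')
  have v1: "0 < v1"
    using v21 v2 m by (smt (verit) mult_pos_pos)
  have mM: "m \<le> M"
    using order_trans[OF v21 v12] v2 by simp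
  have inv_lower: "emeasure N2 A \<le> ennreal (1 / m) * emeasure N1 A" if "A \<in> sets N2" for A
    using lower[OF that] m
    by (simp add: N1.emeasure_eq_measure N2.emeasure_eq_measure pos_le_divide_eq mult.commute
        flip: ennreal_mult')
  have p12: "(\<integral>x. f x - a \<partial>N1) \<le> M * (\<integral>x. f x - a \<partial>N2)"
    using sets upper M i2 f(2) by (intro integral_le_mult_of_measure_le) auto
  have "(\<integral>x. f x - a \<partial>N2) \<le> 1 / m * (\<integral>x. f x - a \<partial>N1)"
    using sets inv_lower m i1 f(2) sp by (intro integral_le_mult_of_measure_le) auto
  hence p21: "m * (\<integral>x. f x - a \<partial>N2) \<le> (\<integral>x. f x - a \<partial>N1)"
    using m by (simp add: field_simps)
  have shift1: "integral\<^sup>L N1 f / v1 = A1 + a"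
    using v1 i1 by (simp add: A1_def v1_def field_simps)
  have shift2: "integral\<^sup>L N2 f / v2 = A2 + a"
    using v2 i2 by (simp add: A2_def v2_def field_simps)
  have A_nonneg: "0 \<le> A1" "0 \<le> A2"
    using f(2) sp v1 v2 unfolding A1_def A2_def by (auto intro!: divide_nonneg_pos integral_nonneg_AE)
  have "(\<integral>x. f x - a \<partial>N1) \<le> (\<integral>x. b - a \<partial>N1)" "(\<integral>x. f x - a \<partial>N2) \<le> (\<integral>x. b - a \<partial>N2)"
    using i1 i2 f(3) sp by (intro integral_mono; simp)+
  hence A_le: "A1 \<le> b - a" "A2 \<le> b - a"
    using v1 v2 by (auto simp: A1_def A2_def v1_def v2_def field_simps)
  have "A1 \<le> (M * (\<integral>x. f x - a \<partial>N2)) / (m * v2)"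
    unfolding A1_def using p12 v21 v1 v2 m A_nonneg
    by (intro frac_le) (auto simp: A2_def M less_imp_le zero_le_divide_iff)
  hence A12: "A1 \<le> M / m * A2"
    by (simp add: A2_def)
  have "m * (\<integral>x. f x - a \<partial>N2) / (M * v2) \<le> A1"
    unfolding A1_def using p21 v12 v1 v2 m A_nonneg
    by (intro frac_le) (auto simp: A1_def M less_imp_le zero_le_divide_iff)
  hence "m * A2 / M \<le> A1"
    by (simp add: A2_def mult.commute)
  hence A21: "A2 \<le> M / m * A1"
    using m M by (simp add: pos_divide_le_eq pos_le_divide_eq mult.commute)
  have r: "0 \<le> M / m - 1"
    using mM m by simp
  have "A1 - A2 \<le> (M / m - 1) * A2" "A2 - A1 \<le> (M / m - 1) * A1"
    using A12 A21 by (auto simp: algebra_simps)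
  moreover have "(M / m - 1) * A2 \<le> (M / m - 1) * (b - a)" "(M / m - 1) * A1 \<le> (M / m - 1) * (b - a)"
    using A_le r by (auto intro: mult_left_mono)
  ultimately have "\<bar>A1 - A2\<bar> \<le> (b - a) * (M / m - 1)"
    by (simp add: mult.commute)
  thus ?thesis
    by (simp add: shift1 shift2 flip: v1_def v2_def)
qed

section \<open>Comparison of the measure with Lebesgue measure on an interval\<close>

text \<open>
  A set of the completion differs from a measurable set by part of a null set, which can be cut
  down to \<open>J\<close>. Hence the completion, inside \<open>J\<close>, depends only on the measurable sets and null sets
  inside \<open>J\<close>.
\<close>

lemma sets_completion_transfer:
  assumes A: "A \<in> sets (completion M)" "A \<subseteq> J" and J: "J \<in> sets M"
    and sets: "\<And>X. X \<in> sets M \<Longrightarrow> X \<subseteq> J \<Longrightarrow> X \<in> sets N"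
    and null: "\<And>X. X \<in> null_sets M \<Longrightarrow> X \<subseteq> J \<Longrightarrow> X \<in> null_sets N"
  shows "A \<in> sets (completion N)"
proof -
  obtain S T T' where *: "A = S \<union> T" "T \<subseteq> T'" "T' \<in> null_sets M" "S \<in> sets M"
    using A(1) by (rule sets_completionE)
  have "T' \<inter> J \<in> null_sets N"
    using * J by (intro null null_set_Int2) auto
  moreover have "S \<in> sets N"
    using * A(2) by (intro sets) auto
  moreover have "T \<subseteq> T' \<inter> J"
    using * A(2) by auto
  ultimately show ?thesis
    using *(1) by (rule_tac sets_completionI) auto
qed

lemma nondegenerate_interval_greaterThanLessThan:
  fixes c d :: real
  assumes "c < d"
  shows "nondegenerate_interval {c<..<d}"
proof -
  obtain u where u: "c < u" "u < d"
    using dense assms by blast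
  obtain v where v: "u < v" "v < d"
    using dense u(2) by blast
  show ?thesis
    unfolding nondegenerate_interval_def using u v is_interval_oo[of c d]
    by (intro conjI bexI[of _ u] bexI[of _ v]) auto
qed

lemma p_borel_measure_on_sets_iff:
  assumes "p_borel_measure_on S \<mu>" "X \<subseteq> S"
  shows "X \<in> sets \<mu> \<longleftrightarrow> X \<in> sets borel"
proof -
  have "S \<in> sets borel"
    using assms(1) by (intro real_interval_borel_measurable) (simp add: p_borel_measure_on_def)
  thus ?thesis
    using assms by (auto simp: p_borel_measure_on_def sets_restrict_space_iff)
qed

text \<open>
  For \<open>\<mu>(A) > 0\<close> the lower bound is the definition of the ratio. To include \<open>\<mu>(A) = 0\<close>, apply it to
  \<open>A \<union> C n\<close>, where the intervals \<open>C n\<close> shrink to the empty set: their \<open>\<mu>\<close>-measures are positive, as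
  required of a p-Borel measure, and tend to 0 by continuity from above. For the upper bound the
  finiteness of the ratio is essential when \<open>\<lambda>(A) = 0\<close>: positive \<open>\<mu>(A)\<close> would make a quotient
  infinite.
\<close>

lemma density_bounds_interval:
  assumes p: "p_borel_measure_on S \<mu>" and ab: "a < b" and sub: "{a<..<b} \<subseteq> S"
    and A: "A \<subseteq> {a<..<b}" "mu_measurable \<mu> A" "A \<in> sets lebesgue"
  shows lower_ratio_mult_le: "lower_ratio \<mu> {a<..<b} * emeasure lebesgue A \<le> emeasure (completion \<mu>) A"
    and le_upper_ratio_mult:
      "upper_ratio \<mu> {a<..<b} < \<infinity> \<Longrightarrow>
         emeasure (completion \<mu>) A \<le> upper_ratio \<mu> {a<..<b} * emeasure lebesgue A"
proof -
  have meas: "X \<in> sets \<mu>" if "X \<in> sets borel" "X \<subseteq> S" for X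
    using that p_borel_measure_on_sets_iff[OF p] by blast
  have fin_J: "emeasure \<mu> {a<..<b} < \<infinity>"
    using p meas[of "{a<..<b}"] sub unfolding p_borel_measure_on_def by auto
  have fin: "emeasure (completion \<mu>) X < \<infinity>" if "X \<subseteq> {a<..<b}" for X
  proof -
    have "emeasure (completion \<mu>) X \<le> emeasure (completion \<mu>) {a<..<b}"
      using that meas sub by (intro emeasure_mono) auto
    thus ?thesis using fin_J meas[of "{a<..<b}"] sub by (simp add: le_less_trans)
  qed
  have dom: "X \<in> Dom_mean \<mu>"
    if "X \<subseteq> {a<..<b}" "mu_measurable \<mu> X" "0 < emeasure (completion \<mu>) X" for X
    using that fin[of X] bounded_subset[of "{a<..<b}" X]
    by (auto simp: Dom_mean_def)
  have fin_leb: "emeasure lebesgue X < \<infinity>" if "X \<subseteq> {a<..<b}" "X \<in> sets lebesgue" for X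
    using bounded_set_imp_lmeasurable[of X] that bounded_subset[of "{a<..<b}" X]
    by (auto simp: fmeasurable_def)
  have lower_dom: "lower_ratio \<mu> {a<..<b} * emeasure lebesgue X \<le> emeasure (completion \<mu>) X"
    if X: "X \<subseteq> {a<..<b}" "mu_measurable \<mu> X" "X \<in> sets lebesgue" "0 < emeasure (completion \<mu>) X" for X
  proof (cases "emeasure lebesgue X = 0")
    case False
    have "lower_ratio \<mu> {a<..<b} \<le> emeasure (completion \<mu>) X / emeasure lebesgue X"
      unfolding lower_ratio_def density_ratios_def using X dom by (intro Inf_lower) blast
    hence "lower_ratio \<mu> {a<..<b} * emeasure lebesgue X
             \<le> emeasure (completion \<mu>) X / emeasure lebesgue X * emeasure lebesgue X"
      by (rule mult_right_mono) simp
    also have "\<dots> = emeasure (completion \<mu>) X"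
      using False fin_leb[OF X(1,3)] by (simp add: ennreal_divide_times)
    finally show ?thesis .
  qed simp
  \<comment> \<open>Intervals of positive but vanishing \<open>\<mu>\<close>-measure; their left endpoint is excluded, so that
     they have no common point.\<close>
  define C where "C n = {a<..<a + (b - a) / real (Suc n)}" for n
  have C_sub: "C n \<subseteq> {a<..<b}" for n
  proof -
    have "(b - a) / real (Suc n) \<le> (b - a) / 1"
      using ab by (intro divide_left_mono) auto
    thus ?thesis by (auto simp: C_def)
  qed
  have C_meas: "C n \<in> sets \<mu>" for n
    using C_sub[of n] sub by (intro meas) (auto simp: C_def)
  have C_pos: "0 < emeasure \<mu> (C n)" for n
  proof -
    have "nondegenerate_interval (C n)"
      unfolding C_def using ab by (intro nondegenerate_interval_greaterThanLessThan) simp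
    thus ?thesis
      using p C_sub[of n] sub unfolding p_borel_measure_on_def by blast
  qed
  have C_lim: "(\<lambda>n. emeasure \<mu> (C n)) \<longlonglongrightarrow> 0"
  proof -
    have "decseq C"
      unfolding C_def decseq_def using ab
      by (auto intro!: divide_left_mono elim!: less_le_trans)
    moreover have "emeasure \<mu> (C n) \<noteq> \<infinity>" for n
      using fin[OF C_sub[of n]] C_meas[of n] by simp
    ultimately have "(\<lambda>n. emeasure \<mu> (C n)) \<longlonglongrightarrow> emeasure \<mu> (\<Inter>n. C n)"
      using C_meas by (intro Lim_emeasure_decseq) auto
    moreover have "(\<Inter>n. C n) = {}"
    proof (rule ccontr)
      assume "(\<Inter>n. C n) \<noteq> {}"
      then obtain y where y: "\<And>n. y \<in> C n" by blast
      have "(\<lambda>n. a + (b - a) / real (Suc n)) \<longlonglongrightarrow> a + 0"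
        by (intro tendsto_intros LIMSEQ_Suc lim_const_over_n)
      moreover have "\<exists>N. \<forall>n\<ge>N. y \<le> a + (b - a) / real (Suc n)"
        using y by (auto simp: C_def less_imp_le)
      ultimately have "y \<le> a + 0"
        by (rule LIMSEQ_le_const)
      thus False using y[of 0] by (simp add: C_def)
    qed
    ultimately show ?thesis by simp
  qed
  show "lower_ratio \<mu> {a<..<b} * emeasure lebesgue A \<le> emeasure (completion \<mu>) A"
  proof -
    have "lower_ratio \<mu> {a<..<b} * emeasure lebesgue A \<le> emeasure (completion \<mu>) A + emeasure \<mu> (C n)" for n
    proof -
      have Cm: "mu_measurable \<mu> (C n)" "C n \<in> sets lebesgue"
        using C_meas by (auto simp: C_def)
      have "0 < emeasure (completion \<mu>) (C n)"
        using C_pos C_meas by simp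
      also have "\<dots> \<le> emeasure (completion \<mu>) (A \<union> C n)"
        using A Cm by (intro emeasure_mono) auto
      finally have "0 < emeasure (completion \<mu>) (A \<union> C n)" .
      hence "lower_ratio \<mu> {a<..<b} * emeasure lebesgue (A \<union> C n) \<le> emeasure (completion \<mu>) (A \<union> C n)"
        using A C_sub Cm by (intro lower_dom) auto
      also have "\<dots> \<le> emeasure (completion \<mu>) A + emeasure (completion \<mu>) (C n)"
        using A Cm by (intro emeasure_subadditive)
      finally have "lower_ratio \<mu> {a<..<b} * emeasure lebesgue (A \<union> C n)
          \<le> emeasure (completion \<mu>) A + emeasure \<mu> (C n)"
        using C_meas by simp
      moreover have "lower_ratio \<mu> {a<..<b} * emeasure lebesgue A
          \<le> lower_ratio \<mu> {a<..<b} * emeasure lebesgue (A \<union> C n)"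
        using A Cm by (intro mult_left_mono emeasure_mono) auto
      ultimately show ?thesis by simp
    qed
    moreover have "(\<lambda>n. emeasure (completion \<mu>) A + emeasure \<mu> (C n)) \<longlonglongrightarrow> emeasure (completion \<mu>) A + 0"
      by (intro tendsto_add tendsto_const C_lim)
    ultimately have "lower_ratio \<mu> {a<..<b} * emeasure lebesgue A \<le> emeasure (completion \<mu>) A + 0"
      by (intro LIMSEQ_le_const) auto
    thus ?thesis by simp
  qed
  show "emeasure (completion \<mu>) A \<le> upper_ratio \<mu> {a<..<b} * emeasure lebesgue A"
    if M: "upper_ratio \<mu> {a<..<b} < \<infinity>"
  proof (cases "emeasure (completion \<mu>) A = 0")
    case False
    hence pos: "0 < emeasure (completion \<mu>) A"
      by (simp add: zero_less_iff_neq_zero)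
    have le: "emeasure (completion \<mu>) A / emeasure lebesgue A \<le> upper_ratio \<mu> {a<..<b}"
      unfolding upper_ratio_def density_ratios_def using A dom pos by (intro Sup_upper) blast
    have "emeasure lebesgue A \<noteq> 0"
      using le M False by (auto simp: top_unique)
    hence "emeasure (completion \<mu>) A = emeasure (completion \<mu>) A / emeasure lebesgue A * emeasure lebesgue A"
      using fin_leb[OF A(1,3)] by (simp add: ennreal_divide_times)
    also have "\<dots> \<le> upper_ratio \<mu> {a<..<b} * emeasure lebesgue A"
      using le by (rule mult_right_mono) simp
    finally show ?thesis .
  qed simp
qed

text \<open>
  Positivity of the lower ratio turns \<open>\<mu>\<close>-null Borel sets into Lebesgue null sets, finiteness of the
  upper ratio does the converse.
\<close>

lemma mu_measurable_iff_lebesgue_interval: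
  assumes p: "p_borel_measure_on S \<mu>" and ab: "a < b" and sub: "{a<..<b} \<subseteq> S"
    and ratio: "0 < lower_ratio \<mu> {a<..<b}" "upper_ratio \<mu> {a<..<b} < \<infinity>"
    and A: "A \<subseteq> {a<..<b}"
  shows "mu_measurable \<mu> A \<longleftrightarrow> A \<in> sets lebesgue"
proof -
  have meas: "X \<in> sets \<mu> \<longleftrightarrow> X \<in> sets borel" if "X \<subseteq> {a<..<b}" for X
    using that sub by (intro p_borel_measure_on_sets_iff[OF p]) auto
  have null: "X \<in> null_sets \<mu> \<longleftrightarrow> X \<in> null_sets lborel" if X: "X \<subseteq> {a<..<b}" for X
  proof (cases "X \<in> sets borel")
    case True
    have "lower_ratio \<mu> {a<..<b} * emeasure lborel X \<le> emeasure \<mu> X"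
         "emeasure \<mu> X \<le> upper_ratio \<mu> {a<..<b} * emeasure lborel X"
      using density_bounds_interval[OF p ab sub X] ratio(2) True meas[OF X] by auto
    thus ?thesis
      using ratio True meas[OF X] by (auto simp: null_sets_def)
  qed (use meas[OF X] in \<open>auto simp: null_sets_def\<close>)
  show ?thesis
  proof
    assume "mu_measurable \<mu> A"
    thus "A \<in> sets lebesgue"
      by (rule sets_completion_transfer[where J="{a<..<b}"]) (use A meas null in auto)
  next
    assume "A \<in> sets lebesgue"
    thus "mu_measurable \<mu> A"
      by (rule sets_completion_transfer[where J="{a<..<b}"]) (use A meas null in auto)
  qed
qed

section \<open>The two means on a translated set\<close>

text \<open>
  Both means are averages of the identity, with values in \<open>(a, b)\<close>, for the restrictions of the two
  completed measures to \<open>A\<close>. These have the same measurable sets and are comparable with constants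
  the two ratios.
\<close>

lemma mean_diff_Avg_le:
  assumes p: "p_borel_measure_on S \<mu>" and ab: "a < b" and sub: "{a<..<b} \<subseteq> S"
    and ratio: "0 < lower_ratio \<mu> {a<..<b}" "upper_ratio \<mu> {a<..<b} < \<infinity>"
    and A: "A \<subseteq> {a<..<b}" "A \<in> sets lebesgue" "0 < measure lebesgue A"
  shows "\<bar>mean \<mu> A - Avg A\<bar>
    \<le> (b - a) * (enn2real (upper_ratio \<mu> {a<..<b} / lower_ratio \<mu> {a<..<b}) - 1)"
proof -
  let ?l = "lower_ratio \<mu> {a<..<b}" and ?u = "upper_ratio \<mu> {a<..<b}"
  define m M where "m = enn2real ?l" and "M = enn2real ?u"
  define N1 N2 where "N1 = restrict_space (completion \<mu>) A" and "N2 = restrict_space lebesgue A"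
  have meas_iff: "mu_measurable \<mu> X \<longleftrightarrow> X \<in> sets lebesgue" if "X \<subseteq> A" for X
    using that A(1) by (intro mu_measurable_iff_lebesgue_interval[OF p ab sub ratio]) auto
  have Am: "mu_measurable \<mu> A"
    using meas_iff A by auto
  have bounds: "?l * emeasure lebesgue X \<le> emeasure (completion \<mu>) X"
      "emeasure (completion \<mu>) X \<le> ?u * emeasure lebesgue X"
    if "X \<subseteq> A" "X \<in> sets lebesgue" for X
  proof -
    have X: "X \<subseteq> {a<..<b}" "mu_measurable \<mu> X"
      using that A(1) meas_iff[of X] by auto
    show "?l * emeasure lebesgue X \<le> emeasure (completion \<mu>) X"
      by (rule lower_ratio_mult_le[OF p ab sub X that(2)])
    show "emeasure (completion \<mu>) X \<le> ?u * emeasure lebesgue X"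
      by (rule le_upper_ratio_mult[OF p ab sub X that(2) ratio(2)])
  qed
  have finA: "emeasure lebesgue A < \<infinity>"
    using bounded_set_imp_lmeasurable[of A] A bounded_subset[of "{a<..<b}" A]
    by (auto simp: fmeasurable_def)
  have posA: "0 < emeasure lebesgue A"
    using A(3) by (metis measure_eq_0_null_sets null_setsI A(2) less_irrefl zero_less_iff_neq_zero)
  have finA1: "emeasure (completion \<mu>) A < \<infinity>"
    using bounds(2)[of A] A(2) ratio(2) finA by (auto simp: ennreal_mult_less_top le_less_trans)
  \<comment> \<open>The lower ratio is an infimum in the extended reals; that it is finite is seen on \<open>A\<close> itself,
     where both measures are finite and positive.\<close>
  have "?l * emeasure lebesgue A < \<infinity>"
    using bounds(1)[of A] A(2) finA1 by (auto intro: le_less_trans)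
  hence l_fin: "?l < \<infinity>"
    using posA by (auto simp: ennreal_mult_less_top)
  have "0 < ?l * emeasure lebesgue A"
    using ratio(1) posA by (simp add: ennreal_zero_less_mult_iff)
  also have "\<dots> \<le> ?u * emeasure lebesgue A"
    using bounds[of A] A(2) by auto
  finally have u_pos: "0 < ?u"
    by (auto simp: ennreal_zero_less_mult_iff)
  have m: "0 < m" "ennreal m = ?l" and M: "0 < M" "ennreal M = ?u"
    using ratio l_fin u_pos by (auto simp: m_def M_def enn2real_positive_iff)
  have quot: "enn2real (?u / ?l) = M / m"
    using m M by (simp add: divide_ennreal flip: m(2) M(2))
  have sp: "space N1 = A" "space N2 = A"
    using Am[THEN sets.sets_into_space] by (auto simp: N1_def N2_def space_restrict_space)
  have e1: "emeasure N1 X = emeasure (completion \<mu>) X" and e2: "emeasure N2 X = emeasure lebesgue X"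
    if "X \<subseteq> A" for X
    using that Am A(2) sets.sets_into_space[OF Am]
    by (auto simp: N1_def N2_def emeasure_restrict_space Int_absorb2)
  have setsN2: "X \<in> sets N2 \<longleftrightarrow> X \<subseteq> A \<and> X \<in> sets lebesgue" for X
    using A(2) by (auto simp: N2_def sets_restrict_space_iff)
  have setsN1: "X \<in> sets N1 \<longleftrightarrow> X \<subseteq> A \<and> X \<in> sets lebesgue" for X
    using Am meas_iff sets.sets_into_space[OF Am]
    by (auto simp: N1_def sets_restrict_space_iff Int_absorb2)
  have m1: "measure N1 (space N1) = measure (completion \<mu>) A"
    and m2: "measure N2 (space N2) = measure lebesgue A"
    by (auto simp: sp e1 e2 measure_def)
  have i1: "(LINT x:A|completion \<mu>. x) = integral\<^sup>L N1 (\<lambda>x. x)"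
    and i2: "(LINT x:A|lebesgue. x) = integral\<^sup>L N2 (\<lambda>x. x)"
    using Am A(2) sets.sets_into_space[OF Am]
    by (auto simp: N1_def N2_def set_lebesgue_integral_def integral_restrict_space Int_absorb2)
  have "\<bar>integral\<^sup>L N1 (\<lambda>x. x) / measure N1 (space N1) - integral\<^sup>L N2 (\<lambda>x. x) / measure N2 (space N2)\<bar>
      \<le> (b - a) * (M / m - 1)"
  proof (rule means_diff_le_of_comparable_measures)
    show "finite_measure N1" "finite_measure N2"
      using finA finA1 by (auto intro!: finite_measureI simp: sp e1 e2)
    show "sets N1 = sets N2"
      using setsN1 setsN2 by auto
    show "(\<lambda>x. x) \<in> borel_measurable N2"
      unfolding N2_def by (intro measurable_restrict_space1 measurable_completion) auto
    show "ennreal m * emeasure N2 X \<le> emeasure N1 X" "emeasure N1 X \<le> ennreal M * emeasure N2 X"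
      if "X \<in> sets N2" for X
      using that bounds[of X] by (auto simp: setsN2 m M e1 e2)
  qed (use m M A sp m2 in auto)
  thus ?thesis
    by (simp add: mean_def Avg_def i1 i2 m1 m2 quot)
qed

theorem theorem4p2:
  fixes \<mu> :: "real measure"
  assumes "p_borel_measure_on {0<..} \<mu>"
    and "\<And>H x. H \<subseteq> {0<..} \<Longrightarrow> mu_measurable \<mu> H \<Longrightarrow> 0 < x \<Longrightarrow> mu_measurable \<mu> (translate H x)"
    and "\<And>I. I \<subseteq> {0<..} \<Longrightarrow> bounded I \<Longrightarrow> nondegenerate_interval I \<Longrightarrow>
           0 < lower_ratio \<mu> I \<and> lower_ratio \<mu> I \<le> upper_ratio \<mu> I \<and> upper_ratio \<mu> I < \<infinity> \<and>
           ((\<lambda>x. upper_ratio \<mu> (translate I x) / lower_ratio \<mu> (translate I x)) \<longlongrightarrow> 1) at_top"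
  shows "\<forall>H\<in>Dom_mean \<mu>.
           ((\<lambda>x. \<bar>mean \<mu> (translate H x) - Avg (translate H x)\<bar>) \<longlongrightarrow> 0) at_top"
proof
  fix H assume H: "H \<in> Dom_mean \<mu>"
  note p = assms(1)
  have "space \<mu> = {0<..}"
    using p sets_eq_imp_space_eq[of \<mu> "restrict_space borel {0<..}"]
    by (simp add: p_borel_measure_on_def space_restrict_space)
  hence H_pos: "H \<subseteq> {0<..}"
    using H sets.sets_into_space[of H "completion \<mu>"] by (auto simp: Dom_mean_def)
  obtain B where B: "0 < B" "\<And>h. h \<in> H \<Longrightarrow> \<bar>h\<bar> < B"
  proof -
    obtain c where "\<And>h. h \<in> H \<Longrightarrow> \<bar>h\<bar> \<le> c" "0 < c"
      using H by (auto simp: Dom_mean_def bounded_pos)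
    thus thesis by (intro that[of "c + 1"]) fastforce+
  qed
  have H_sub: "H \<subseteq> {0<..<B}"
    using B(2) H_pos by fastforce
  note interval = nondegenerate_interval_greaterThanLessThan
  have trans_I: "translate {0<..<B} x = {x<..<B + x}" for x
    by (auto simp: translate_def intro!: exI[of _ "y - x" for y])
  have trans_H: "translate H x = (+) x ` H" for x
    by (auto simp: translate_def)
  have sub0: "{0<..<B} \<subseteq> {0<..}" by auto
  have ratio0: "0 < lower_ratio \<mu> {0<..<B}" "upper_ratio \<mu> {0<..<B} < \<infinity>"
    and lim: "((\<lambda>x. upper_ratio \<mu> {x<..<B + x} / lower_ratio \<mu> {x<..<B + x}) \<longlongrightarrow> 1) at_top"
    using assms(3)[OF sub0 _ interval[OF B(1)]] by (auto simp: trans_I)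
  have H_leb: "H \<in> sets lebesgue"
    using mu_measurable_iff_lebesgue_interval[OF p B(1) sub0 ratio0 H_sub] H by (auto simp: Dom_mean_def)
  have "emeasure lebesgue H \<noteq> 0"
    using le_upper_ratio_mult[OF p B(1) sub0 H_sub _ H_leb] ratio0 H by (auto simp: Dom_mean_def)
  moreover have "H \<in> lmeasurable"
    using bounded_set_imp_lmeasurable H_leb H by (auto simp: Dom_mean_def)
  ultimately have H_meas: "0 < measure lebesgue H"
    by (simp add: emeasure_eq_measure2 zero_less_measure_iff)
  have bound: "\<bar>mean \<mu> (translate H x) - Avg (translate H x)\<bar>
      \<le> B * (enn2real (upper_ratio \<mu> {x<..<B + x} / lower_ratio \<mu> {x<..<B + x}) - 1)" if x: "0 < x" for x
  proof -
    have sub: "{x<..<B + x} \<subseteq> {0<..}" and xB: "x < B + x"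
      using x B by auto
    have "\<bar>mean \<mu> (translate H x) - Avg (translate H x)\<bar>
      \<le> (B + x - x) * (enn2real (upper_ratio \<mu> {x<..<B + x} / lower_ratio \<mu> {x<..<B + x}) - 1)"
    proof (rule mean_diff_Avg_le[OF p xB sub])
      show "0 < lower_ratio \<mu> {x<..<B + x}" "upper_ratio \<mu> {x<..<B + x} < \<infinity>"
        using assms(3)[OF sub _ interval[OF xB]] by auto
      show "translate H x \<subseteq> {x<..<B + x}"
        using H_sub by (auto simp: trans_H)
      show "translate H x \<in> sets lebesgue"
        unfolding trans_H by (rule lebesgue_sets_translation[OF H_leb])
      show "0 < measure lebesgue (translate H x)"
        by (simp add: trans_H measure_translation H_meas)
    qed
    thus ?thesis by simp
  qed
  have "((\<lambda>x. enn2real (upper_ratio \<mu> {x<..<B + x} / lower_ratio \<mu> {x<..<B + x})) \<longlongrightarrow> 1) at_top"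
    by (rule tendsto_enn2real) (use lim in simp_all)
  hence "((\<lambda>x. B * (enn2real (upper_ratio \<mu> {x<..<B + x} / lower_ratio \<mu> {x<..<B + x}) - 1))
      \<longlongrightarrow> B * (1 - 1)) at_top"
    by (intro tendsto_mult_left tendsto_diff tendsto_const)
  hence "((\<lambda>x. B * (enn2real (upper_ratio \<mu> {x<..<B + x} / lower_ratio \<mu> {x<..<B + x}) - 1))
      \<longlongrightarrow> 0) at_top" by simp
  thus "((\<lambda>x. \<bar>mean \<mu> (translate H x) - Avg (translate H x)\<bar>) \<longlongrightarrow> 0) at_top"
    by (rule tendsto_sandwich[OF _ _ tendsto_const, rotated 2])
       (auto intro: eventually_mono[OF eventually_gt_at_top[of 0]] bound)
qed

end
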